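(* Let $\mathcal L$ be one of $\mathrm{FO}(<)$, $\mathrm{FO}(<,\equiv)$ or $\mathrm{FO}(\mathrm{RPR})$. Let $\boldsymbol q=(\mathcal O,\psi(\boldsymbol t))$ be an epistemic temporal ontology-mediated query (EOMQ). If all constituent OMPIQs of $\boldsymbol q$ (i.e. all pairs $(\mathcal O,\varkappa)$ such that an atom of the form $\varkappa(t)$ occurs in $\psi$) are $\mathcal L$-rewritable, then $\boldsymbol q$ is $\mathcal L$-rewritable.
   Context: Fix a countably infinite set of atomic concepts $A_i$. Positive temporal concepts are given by $\varkappa::=\top\mid A_i\mid\varkappa_1\land\varkappa_2\mid\varkappa_1\lor\varkappa_2\mid\bigcirc_F\varkappa\mid\Diamond_F\varkappa\mid\Box_F\varkappa\mid\varkappa_1\,\mathcal U\,\varkappa_2\mid\bigcirc_P\varkappa\mid\Diamond_P\varkappa\mid\Box_P\varkappa\mid\varkappa_1\,\mathcal S\,\varkappa_2$. An interpretation $\mathfrak M$ assigns to each atomic concept $A$ a set $A^{\mathfrak M}\subseteq\mathbb Z$; extensions: $\top^{\mathfrak M}=\mathbb Z$, $\land,\lor$ are $\cap,\cup$, $(\bigcirc_F\varkappa)^{\mathfrak M}=\{n\mid n+1\in\varkappa^{\mathfrak M}\}$, $(\Box_F\varkappa)^{\mathfrak M}=\{n\mid k\in\varkappa^{\mathfrak M}\ \forall k>n\}$, $(\Diamond_F\varkappa)^{\mathfrak M}=\{n\mid\exists k>n,\ k\in\varkappa^{\mathfrak M}\}$, $(\varkappa_1\,\mathcal U\,\varkappa_2)^{\mathfrak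 M}=\{n\mid\exists k>n,\ k\in\varkappa_2^{\mathfrak M}\text{ and }m\in\varkappa_1^{\mathfrak M}\text{ for all }n<m<k\}$, and symmetrically for the past operators. An ontology $\mathcal O$ is a finite set of clauses $C_1\land\dots\land C_k\to C_{k+1}\lor\dots\lor C_{k+m}$, $k,m\ge0$, where each $C_i$ is an atomic concept prefixed by a sequence of operators from $\Box_F,\Box_P,\bigcirc_F,\bigcirc_P$; a clause is true in $\mathfrak M$ if $\bigcap_{i\le k}C_i^{\mathfrak M}\subseteq\bigcup_{j=1}^{m}C_{k+j}^{\mathfrak M}$ (empty $\bigcap$ is $\mathbb Z$, empty $\bigcup$ is $\emptyset$). A data instance $\mathcal A$ is a finite set of ground atoms $A_i(\ell)$, $\ell\in\mathbb Z$; it is assumed throughout that the least integer $\min\mathcal A$ occurring in it is $0$ and the greatest one satisfies $\max\mathcal A\ge1$; $\mathrm{tem}(\mathcal A)=\{n\in\mathbb Z\mid\min\mathcal A\le n\le\max\mathcal A\}$. $\mathfrak M$ is a model of $(\mathcal O,\mathcal A)$ if all clauses of $\mathcal O$ are true in $\mathfrak M$ and $\ell\in A^{\mathfrak M}$ for all $A(\ell)\in\mathcal A$. An OMPIQ is a pair $(\mathcal O,\varkappa)$ with $\varkappa$ a positive temporal concept; $\mathrm{ans}(\mathcal O,\varkappa,\mathcal A)=\{\ell\in\mathrm{tem}(\mathcal A)\mid\ell\in\varkappa^{\mathfrak M}\text{ for every model }\mathfrak M\text{ of }(\mathcal O,\mathcal A)\}$. An EOMQ is a pair $\boldsymbol q=(\mathcal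 O,\psi(\boldsymbol t))$, where $\psi(\boldsymbol t)$ is a first-order formula with free variables $\boldsymbol t$ built from atoms $\varkappa(t)$, $(t<t')$ and the abbreviations $(t=t')$, $(t=t'+1)$, with $\varkappa$ positive temporal concepts. It is evaluated over the structure $\mathfrak G_{\mathcal O,\mathcal A}$ with domain $\mathrm{tem}(\mathcal A)$: under an assignment $\mathfrak a$ of variables to elements of $\mathrm{tem}(\mathcal A)$, $\varkappa(t)$ is true iff $\mathfrak a(t)\in\mathrm{ans}(\mathcal O,\varkappa,\mathcal A)$, $t<t'$ is true iff $\mathfrak a(t)<\mathfrak a(t')$, with the standard clauses for Boolean connectives and for first-order quantifiers ranging over $\mathrm{tem}(\mathcal A)$. A tuple $\boldsymbol\ell$ in $\mathrm{tem}(\mathcal A)$ is an answer to $\boldsymbol q$ over $\mathcal A$ if $\mathfrak G_{\mathcal O,\mathcal A}\models\psi(\boldsymbol\ell)$. $\mathfrak S_{\mathcal A}$ is the finite first-order structure with domain $\mathrm{tem}(\mathcal A)$ ordered by $<$ in which $A(\ell)$ holds iff $A(\ell)\in\mathcal A$. An OMPIQ $(\mathcal O,\varkappa)$ is $\mathcal L$-rewritable if there is a constant-free $\mathcal L$-formula $\boldsymbol Q(t)$ such that $\mathrm{ans}(\mathcal O,\varkappa,\mathcal A)=\{\ell\in\mathrm{tem}(\mathcal A)\mid\mathfrak S_{\mathcal A}\models\boldsymbol Q(\ell)\}$ for every data instance $\mathcal A$. An EOMQ $\boldsymbol q$ is $\mathcal L$-rewritable if there is an $\mathcal L$-formula $\boldsymbol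 Q(\boldsymbol t)$ such that, for every data instance $\mathcal A$ and every tuple $\boldsymbol\ell$ in $\mathrm{tem}(\mathcal A)$, $\boldsymbol\ell$ is an answer to $\boldsymbol q$ over $\mathcal A$ iff $\mathfrak S_{\mathcal A}\models\boldsymbol Q(\boldsymbol\ell)$. $\mathrm{FO}(<)$ is first-order logic over the unary predicates for atomic concepts and $<$. $\mathrm{FO}(<,\equiv)$ additionally has unary predicates $t\equiv0\pmod n$, for each fixed $n>1$, true of $\ell$ iff $n$ divides $\ell$. $\mathrm{FO}(\mathrm{RPR})$ extends first-order logic over the unary predicates and the successor relation with relational primitive recursion (in which $<$ is definable): if $\Theta_1,\dots,\Theta_n,\Psi$ are $\mathrm{FO}(\mathrm{RPR})$-formulas, one may form $\big[Q_i(\boldsymbol z_i,t)\equiv\Theta_i(\boldsymbol z_i,t,Q_1(\boldsymbol z_1,t-1),\dots,Q_n(\boldsymbol z_n,t-1)),\ 1\le i\le n\big]\ \Psi(\boldsymbol z,\boldsymbol z_1,\dots,\boldsymbol z_n)$, where the bracketed part defines the relations $Q_i$ used in $\Psi$ by recursion on $t=0,1,2,\dots$ in $\mathrm{tem}(\mathcal A)$, with all $Q_i(\boldsymbol z_i,-1)$ taken to be false; each relation variable $Q_i$ occurs in only one recursive definition. *)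

theory Defs
  imports Main
begin

text \<open>Positive temporal concepts, over atomic concepts indexed by natural numbers. The
  temporal operators are strict.\<close>

datatype pconcept =
    CTop
  | CAtom nat
  | CAnd pconcept pconcept
  | COr pconcept pconcept
  | NextF pconcept
  | DiamondF pconcept
  | BoxF pconcept
  | Until pconcept pconcept
  | NextP pconcept
  | DiamondP pconcept
  | BoxP pconcept
  | Since pconcept pconcept

primrec ext :: "(nat \<Rightarrow> int set) \<Rightarrow> pconcept \<Rightarrow> int set" where
  "ext M CTop = UNIV"
| "ext M (CAtom A) = M A"
| "ext M (CAnd C D) = ext M C \<inter> ext M D"
| "ext M (COr C D) = ext M C \<union> ext M D"
| "ext M (NextF C) = {n. n + 1 \<in> ext M C}"
| "ext M (DiamondF C) = {n. \<exists>k>n. k \<in> ext M C}"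
| "ext M (BoxF C) = {n. \<forall>k>n. k \<in> ext M C}"
| "ext M (Until C D) = {n. \<exists>k>n. k \<in> ext M D \<and> (\<forall>m. n < m \<and> m < k \<longrightarrow> m \<in> ext M C)}"
| "ext M (NextP C) = {n. n - 1 \<in> ext M C}"
| "ext M (DiamondP C) = {n. \<exists>k<n. k \<in> ext M C}"
| "ext M (BoxP C) = {n. \<forall>k<n. k \<in> ext M C}"
| "ext M (Since C D) = {n. \<exists>k<n. k \<in> ext M D \<and> (\<forall>m. k < m \<and> m < n \<longrightarrow> m \<in> ext M C)}"

fun basic :: "pconcept \<Rightarrow> bool" where
  "basic (CAtom A) = True"
| "basic (BoxF C) = basic C"
| "basic (BoxP C) = basic C"
| "basic (NextF C) = basic C"
| "basic (NextP C) = basic C"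
| "basic _ = False"

text \<open>A pair \<open>(Cs, Ds)\<close> stands for the clause with conjunction \<open>Cs\<close> on the left and disjunction
  \<open>Ds\<close> on the right.\<close>

type_synonym clause = "pconcept list \<times> pconcept list"

definition ontology :: "clause set \<Rightarrow> bool" where
  "ontology \<O> \<longleftrightarrow> finite \<O> \<and> (\<forall>(Cs, Ds)\<in>\<O>. \<forall>C\<in>set Cs \<union> set Ds. basic C)"

definition clause_true :: "(nat \<Rightarrow> int set) \<Rightarrow> clause \<Rightarrow> bool" where
  "clause_true M c \<longleftrightarrow> (\<Inter>C\<in>set (fst c). ext M C) \<subseteq> (\<Union>C\<in>set (snd c). ext M C)"

text \<open>A pair \<open>(A, l)\<close> in a data instance stands for the ground atom \<open>A(l)\<close>.\<close>

type_synonym data = "(nat \<times> int) set"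

definition data_instance :: "data \<Rightarrow> bool" where
  "data_instance \<A> \<longleftrightarrow>
     finite \<A> \<and> \<A> \<noteq> {} \<and> Min (snd ` \<A>) = 0 \<and> Max (snd ` \<A>) \<ge> 1"

definition tem :: "data \<Rightarrow> int set" where
  "tem \<A> = {Min (snd ` \<A>)..Max (snd ` \<A>)}"

definition model :: "(nat \<Rightarrow> int set) \<Rightarrow> clause set \<Rightarrow> data \<Rightarrow> bool" where
  "model M \<O> \<A> \<longleftrightarrow> (\<forall>c\<in>\<O>. clause_true M c) \<and> (\<forall>(A, l)\<in>\<A>. l \<in> M A)"

definition ans :: "clause set \<Rightarrow> pconcept \<Rightarrow> data \<Rightarrow> int set" where
  "ans \<O> \<kappa> \<A> = {l \<in> tem \<A>. \<forall>M. model M \<O> \<A> \<longrightarrow> l \<in> ext M \<kappa>}"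

text \<open>Individual variables are natural numbers. \<open>EEq x y\<close> is \<open>x = y\<close> and \<open>ESucc x y\<close> is
  \<open>x = y + 1\<close>; both are definable from \<open>ELess\<close>.\<close>

datatype eform =
    EConcept pconcept nat
  | ELess nat nat
  | EEq nat nat
  | ESucc nat nat
  | ENot eform
  | EAnd eform eform
  | EOr eform eform
  | EImp eform eform
  | EEx nat eform
  | EAll nat eform

primrec efv :: "eform \<Rightarrow> nat set" where
  "efv (EConcept \<kappa> x) = {x}"
| "efv (ELess x y) = {x, y}"
| "efv (EEq x y) = {x, y}"
| "efv (ESucc x y) = {x, y}"
| "efv (ENot \<phi>) = efv \<phi>"
| "efv (EAnd \<phi> \<psi>) = efv \<phi> \<union> efv \<psi>"
| "efv (EOr \<phi> \<psi>) = efv \<phi> \<union> efv \<psi>"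
| "efv (EImp \<phi> \<psi>) = efv \<phi> \<union> efv \<psi>"
| "efv (EEx x \<phi>) = efv \<phi> - {x}"
| "efv (EAll x \<phi>) = efv \<phi> - {x}"

primrec constituents :: "eform \<Rightarrow> pconcept set" where
  "constituents (EConcept \<kappa> x) = {\<kappa>}"
| "constituents (ELess x y) = {}"
| "constituents (EEq x y) = {}"
| "constituents (ESucc x y) = {}"
| "constituents (ENot \<phi>) = constituents \<phi>"
| "constituents (EAnd \<phi> \<psi>) = constituents \<phi> \<union> constituents \<psi>"
| "constituents (EOr \<phi> \<psi>) = constituents \<phi> \<union> constituents \<psi>"
| "constituents (EImp \<phi> \<psi>) = constituents \<phi> \<union> constituents \<psi>"
| "constituents (EEx x \<phi>) = constituents \<phi>"
| "constituents (EAll x \<phi>) = constituents \<phi>"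

primrec esat :: "clause set \<Rightarrow> data \<Rightarrow> (nat \<Rightarrow> int) \<Rightarrow> eform \<Rightarrow> bool" where
  "esat \<O> \<A> e (EConcept \<kappa> x) \<longleftrightarrow> e x \<in> ans \<O> \<kappa> \<A>"
| "esat \<O> \<A> e (ELess x y) \<longleftrightarrow> e x < e y"
| "esat \<O> \<A> e (EEq x y) \<longleftrightarrow> e x = e y"
| "esat \<O> \<A> e (ESucc x y) \<longleftrightarrow> e x = e y + 1"
| "esat \<O> \<A> e (ENot \<phi>) \<longleftrightarrow> \<not> esat \<O> \<A> e \<phi>"
| "esat \<O> \<A> e (EAnd \<phi> \<psi>) \<longleftrightarrow> esat \<O> \<A> e \<phi> \<and> esat \<O> \<A> e \<psi>"
| "esat \<O> \<A> e (EOr \<phi> \<psi>) \<longleftrightarrow> esat \<O> \<A> e \<phi> \<or> esat \<O> \<A> e \<psi>"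
| "esat \<O> \<A> e (EImp \<phi> \<psi>) \<longleftrightarrow> (esat \<O> \<A> e \<phi> \<longrightarrow> esat \<O> \<A> e \<psi>)"
| "esat \<O> \<A> e (EEx x \<phi>) \<longleftrightarrow> (\<exists>l\<in>tem \<A>. esat \<O> \<A> (e(x := l)) \<phi>)"
| "esat \<O> \<A> e (EAll x \<phi>) \<longleftrightarrow> (\<forall>l\<in>tem \<A>. esat \<O> \<A> (e(x := l)) \<phi>)"

definition assign :: "(nat \<Rightarrow> int) \<Rightarrow> nat list \<Rightarrow> int list \<Rightarrow> nat \<Rightarrow> int" where
  "assign e xs ls = (\<lambda>x. case map_of (zip xs ls) x of None \<Rightarrow> e x | Some l \<Rightarrow> l)"

text \<open>\<open>xs\<close> lists the free variables of \<open>\<psi>\<close>, so the base assignment is immaterial.\<close>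

definition eomq_answer :: "clause set \<Rightarrow> eform \<Rightarrow> nat list \<Rightarrow> data \<Rightarrow> int list \<Rightarrow> bool" where
  "eomq_answer \<O> \<psi> xs \<A> ls \<longleftrightarrow> esat \<O> \<A> (assign (\<lambda>_. 0) xs ls) \<psi>"

text \<open>One syntax for all three logics; \<open>in_logic\<close> below selects the fragments. The atoms are
  \<open>Pred A x\<close> for \<open>A(x)\<close>, \<open>Succ x y\<close> for \<open>x = y + 1\<close>, \<open>Cong x n\<close> for \<open>x \<equiv> 0 (mod n)\<close>,
  \<open>Rel Q ys x\<close> for \<open>Q(ys, x)\<close> and \<open>RelPrev Q ys x\<close> for \<open>Q(ys, x - 1)\<close>, where \<open>Q\<close> is a relation
  variable. \<open>Rpr ds t \<Psi>\<close> with \<open>ds = [(Q\<^sub>1, zs\<^sub>1, \<Theta>\<^sub>1), \<dots>, (Q\<^sub>n, zs\<^sub>n, \<Theta>\<^sub>n)]\<close> stands for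
  \<open>[Q\<^sub>1(zs\<^sub>1, t) \<equiv> \<Theta>\<^sub>1, \<dots>, Q\<^sub>n(zs\<^sub>n, t) \<equiv> \<Theta>\<^sub>n] \<Psi>\<close>.\<close>

datatype form =
    Pred nat nat
  | Eq nat nat
  | Less nat nat
  | Succ nat nat
  | Cong nat nat
  | Rel nat "nat list" nat
  | RelPrev nat "nat list" nat
  | Neg form
  | And form form
  | Or form form
  | Imp form form
  | Ex nat form
  | All nat form
  | Rpr "(nat \<times> nat list \<times> form) list" nat form

fun fv :: "form \<Rightarrow> nat set" where
  "fv (Pred A x) = {x}"
| "fv (Eq x y) = {x, y}"
| "fv (Less x y) = {x, y}"
| "fv (Succ x y) = {x, y}"
| "fv (Cong x n) = {x}"
| "fv (Rel Q ys x) = insert x (set ys)"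
| "fv (RelPrev Q ys x) = insert x (set ys)"
| "fv (Neg \<phi>) = fv \<phi>"
| "fv (And \<phi> \<psi>) = fv \<phi> \<union> fv \<psi>"
| "fv (Or \<phi> \<psi>) = fv \<phi> \<union> fv \<psi>"
| "fv (Imp \<phi> \<psi>) = fv \<phi> \<union> fv \<psi>"
| "fv (Ex x \<phi>) = fv \<phi> - {x}"
| "fv (All x \<phi>) = fv \<phi> - {x}"
| "fv (Rpr ds t \<psi>) = (\<Union>(Q, zs, \<theta>)\<in>set ds. fv \<theta> - insert t (set zs)) \<union> fv \<psi>"

text \<open>Relation variables are interpreted by \<open>R Q bs k\<close>, the truth value of \<open>Q(bs, k)\<close>.
  \<open>rpr_stage ds t R e m\<close> is the interpretation after the recursion has been carried out for
  \<open>t = 0, \<dots>, m - 1\<close>: the defined relations are false at all other points, in particular at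
  \<open>-1\<close>. The formulas on the right-hand sides are passed as their truth conditions.\<close>

primrec rpr_stage ::
  "(nat \<times> nat list \<times> ((nat \<Rightarrow> int list \<Rightarrow> int \<Rightarrow> bool) \<Rightarrow> (nat \<Rightarrow> int) \<Rightarrow> bool)) list \<Rightarrow> nat \<Rightarrow>
   (nat \<Rightarrow> int list \<Rightarrow> int \<Rightarrow> bool) \<Rightarrow> (nat \<Rightarrow> int) \<Rightarrow> nat \<Rightarrow> (nat \<Rightarrow> int list \<Rightarrow> int \<Rightarrow> bool)" where
  "rpr_stage ds t R e 0 =
     (\<lambda>Q bs k. case map_of ds Q of None \<Rightarrow> R Q bs k | Some _ \<Rightarrow> False)"
| "rpr_stage ds t R e (Suc m) =
     (\<lambda>Q bs k. case map_of ds Q of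
        None \<Rightarrow> R Q bs k
      | Some (zs, \<theta>) \<Rightarrow>
          if k = int m then \<theta> (rpr_stage ds t R e m) ((assign e zs bs)(t := int m))
          else rpr_stage ds t R e m Q bs k)"

fun sat :: "data \<Rightarrow> (nat \<Rightarrow> int list \<Rightarrow> int \<Rightarrow> bool) \<Rightarrow> (nat \<Rightarrow> int) \<Rightarrow> form \<Rightarrow> bool" where
  "sat \<A> R e (Pred A x) \<longleftrightarrow> (A, e x) \<in> \<A>"
| "sat \<A> R e (Eq x y) \<longleftrightarrow> e x = e y"
| "sat \<A> R e (Less x y) \<longleftrightarrow> e x < e y"
| "sat \<A> R e (Succ x y) \<longleftrightarrow> e x = e y + 1"
| "sat \<A> R e (Cong x n) \<longleftrightarrow> int n dvd e x"
| "sat \<A> R e (Rel Q ys x) \<longleftrightarrow> R Q (map e ys) (e x)"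
| "sat \<A> R e (RelPrev Q ys x) \<longleftrightarrow> R Q (map e ys) (e x - 1)"
| "sat \<A> R e (Neg \<phi>) \<longleftrightarrow> \<not> sat \<A> R e \<phi>"
| "sat \<A> R e (And \<phi> \<psi>) \<longleftrightarrow> sat \<A> R e \<phi> \<and> sat \<A> R e \<psi>"
| "sat \<A> R e (Or \<phi> \<psi>) \<longleftrightarrow> sat \<A> R e \<phi> \<or> sat \<A> R e \<psi>"
| "sat \<A> R e (Imp \<phi> \<psi>) \<longleftrightarrow> (sat \<A> R e \<phi> \<longrightarrow> sat \<A> R e \<psi>)"
| "sat \<A> R e (Ex x \<phi>) \<longleftrightarrow> (\<exists>l\<in>tem \<A>. sat \<A> R (e(x := l)) \<phi>)"
| "sat \<A> R e (All x \<phi>) \<longleftrightarrow> (\<forall>l\<in>tem \<A>. sat \<A> R (e(x := l)) \<phi>)"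
| "sat \<A> R e (Rpr ds t \<psi>) \<longleftrightarrow>
     sat \<A> (rpr_stage (map (\<lambda>(Q, zs, \<theta>). (Q, zs, \<lambda>R' e'. sat \<A> R' e' \<theta>)) ds) t R e
              (card (tem \<A>))) e \<psi>"

text \<open>How a relation variable may be used: inside \<open>\<Psi>\<close> it is applied to arbitrary variables
  (\<open>Anywhere\<close> records the number of parameters); inside the right-hand sides \<open>\<Theta>\<^sub>i\<close> it may occur
  only as \<open>Q(zs, t - 1)\<close> for its own tuple \<open>zs\<close> and the recursion variable \<open>t\<close>. The latter are
  the variables of the definition, so an occurrence below a binder that captures one of them does
  not count. This is what keeps \<open>FO(RPR)\<close> within \<open>NC\<^sup>1\<close>: the recursion cannot quantify over
  the previous stage.\<close>

datatype usage = Anywhere nat | Stage "nat list" nat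

definition hide :: "nat set \<Rightarrow> (nat \<rightharpoonup> usage) \<Rightarrow> (nat \<rightharpoonup> usage)" where
  "hide X \<Gamma> = (\<lambda>Q. case \<Gamma> Q of
     Some (Stage zs t) \<Rightarrow> if insert t (set zs) \<inter> X = {} then \<Gamma> Q else None
   | _ \<Rightarrow> \<Gamma> Q)"

fun scoped :: "(nat \<rightharpoonup> usage) \<Rightarrow> form \<Rightarrow> bool" where
  "scoped \<Gamma> (Rel Q ys x) \<longleftrightarrow> \<Gamma> Q = Some (Anywhere (length ys))"
| "scoped \<Gamma> (RelPrev Q ys x) \<longleftrightarrow> \<Gamma> Q = Some (Stage ys x)"
| "scoped \<Gamma> (Neg \<phi>) \<longleftrightarrow> scoped \<Gamma> \<phi>"
| "scoped \<Gamma> (And \<phi> \<psi>) \<longleftrightarrow> scoped \<Gamma> \<phi> \<and> scoped \<Gamma> \<psi>"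
| "scoped \<Gamma> (Or \<phi> \<psi>) \<longleftrightarrow> scoped \<Gamma> \<phi> \<and> scoped \<Gamma> \<psi>"
| "scoped \<Gamma> (Imp \<phi> \<psi>) \<longleftrightarrow> scoped \<Gamma> \<phi> \<and> scoped \<Gamma> \<psi>"
| "scoped \<Gamma> (Ex x \<phi>) \<longleftrightarrow> scoped (hide {x} \<Gamma>) \<phi>"
| "scoped \<Gamma> (All x \<phi>) \<longleftrightarrow> scoped (hide {x} \<Gamma>) \<phi>"
| "scoped \<Gamma> (Rpr ds t \<psi>) \<longleftrightarrow>
     (\<forall>(Q, zs, \<theta>)\<in>set ds.
        distinct (t # zs) \<and>
        fv \<theta> \<subseteq> insert t (\<Union>(Q', zs', \<theta>')\<in>set ds. set zs') \<and>
        scoped (hide (insert t (set zs)) \<Gamma> ++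
                map_of (map (\<lambda>(Q', zs', \<theta>'). (Q', Stage zs' t)) ds)) \<theta>) \<and>
     scoped (\<Gamma> ++ map_of (map (\<lambda>(Q', zs', \<theta>'). (Q', Anywhere (length zs'))) ds)) \<psi>"
| "scoped \<Gamma> _ \<longleftrightarrow> True"

fun defined_rels :: "form \<Rightarrow> nat list" where
  "defined_rels (Neg \<phi>) = defined_rels \<phi>"
| "defined_rels (And \<phi> \<psi>) = defined_rels \<phi> @ defined_rels \<psi>"
| "defined_rels (Or \<phi> \<psi>) = defined_rels \<phi> @ defined_rels \<psi>"
| "defined_rels (Imp \<phi> \<psi>) = defined_rels \<phi> @ defined_rels \<psi>"
| "defined_rels (Ex x \<phi>) = defined_rels \<phi>"
| "defined_rels (All x \<phi>) = defined_rels \<phi>"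
| "defined_rels (Rpr ds t \<psi>) =
     concat (map (\<lambda>(Q, zs, \<theta>). Q # defined_rels \<theta>) ds) @ defined_rels \<psi>"
| "defined_rels _ = []"

datatype logic = FO_less | FO_less_cong | FO_RPR

text \<open>First-order logic is taken with equality. In \<open>FO_RPR\<close> the order is not primitive.\<close>

fun in_logic :: "logic \<Rightarrow> form \<Rightarrow> bool" where
  "in_logic L (Pred A x) \<longleftrightarrow> True"
| "in_logic L (Eq x y) \<longleftrightarrow> True"
| "in_logic L (Less x y) \<longleftrightarrow> L \<in> {FO_less, FO_less_cong}"
| "in_logic L (Succ x y) \<longleftrightarrow> L = FO_RPR"
| "in_logic L (Cong x n) \<longleftrightarrow> L = FO_less_cong \<and> n > 1"
| "in_logic L (Rel Q ys x) \<longleftrightarrow> L = FO_RPR"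
| "in_logic L (RelPrev Q ys x) \<longleftrightarrow> L = FO_RPR"
| "in_logic L (Neg \<phi>) \<longleftrightarrow> in_logic L \<phi>"
| "in_logic L (And \<phi> \<psi>) \<longleftrightarrow> in_logic L \<phi> \<and> in_logic L \<psi>"
| "in_logic L (Or \<phi> \<psi>) \<longleftrightarrow> in_logic L \<phi> \<and> in_logic L \<psi>"
| "in_logic L (Imp \<phi> \<psi>) \<longleftrightarrow> in_logic L \<phi> \<and> in_logic L \<psi>"
| "in_logic L (Ex x \<phi>) \<longleftrightarrow> in_logic L \<phi>"
| "in_logic L (All x \<phi>) \<longleftrightarrow> in_logic L \<phi>"
| "in_logic L (Rpr ds t \<psi>) \<longleftrightarrow>
     L = FO_RPR \<and> (\<forall>(Q, zs, \<theta>)\<in>set ds. in_logic L \<theta>) \<and> in_logic L \<psi>"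

text \<open>Formulas of the logic have no free relation variables, and every relation variable is
  defined in only one place. Both conditions are void for \<open>FO_less\<close> and \<open>FO_less_cong\<close>.\<close>

definition is_formula :: "logic \<Rightarrow> form \<Rightarrow> bool" where
  "is_formula L \<phi> \<longleftrightarrow> in_logic L \<phi> \<and> scoped Map.empty \<phi> \<and> distinct (defined_rels \<phi>)"

text \<open>Truth of \<open>\<phi>\<close> in the finite structure given by the data, for the tuple \<open>ls\<close> of values of
  the variables \<open>xs\<close>. The initial interpretation of relation variables is immaterial.\<close>

definition holds :: "data \<Rightarrow> form \<Rightarrow> nat list \<Rightarrow> int list \<Rightarrow> bool" where
  "holds \<A> \<phi> xs ls \<longleftrightarrow> sat \<A> (\<lambda>_ _ _. False) (assign (\<lambda>_. 0) xs ls) \<phi>"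

definition ompiq_rewritable :: "logic \<Rightarrow> clause set \<Rightarrow> pconcept \<Rightarrow> bool" where
  "ompiq_rewritable L \<O> \<kappa> \<longleftrightarrow>
     (\<exists>\<phi> x. is_formula L \<phi> \<and> fv \<phi> \<subseteq> {x} \<and>
        (\<forall>\<A>. data_instance \<A> \<longrightarrow> ans \<O> \<kappa> \<A> = {l \<in> tem \<A>. holds \<A> \<phi> [x] [l]}))"

definition eomq_rewritable :: "logic \<Rightarrow> clause set \<Rightarrow> eform \<Rightarrow> nat list \<Rightarrow> bool" where
  "eomq_rewritable L \<O> \<psi> xs \<longleftrightarrow>
     (\<exists>\<phi>. is_formula L \<phi> \<and> fv \<phi> \<subseteq> set xs \<and>
        (\<forall>\<A> ls. data_instance \<A> \<and> length ls = length xs \<and> set ls \<subseteq> tem \<A> \<longrightarrow>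
           (eomq_answer \<O> \<psi> xs \<A> ls \<longleftrightarrow> holds \<A> \<phi> xs ls)))"

end

theory Submission imports Defs begin

text \<open>
  Replace every atom \<open>\<kappa>(y)\<close> of \<open>\<psi>\<close> by a rewriting \<open>\<phi>(x)\<close> of \<open>(\<O>, \<kappa>)\<close>, relativised as
  \<open>\<exists>x. x = y \<and> \<phi>\<close>. Two points need care: the relation variables of different copies must be kept
  apart, so one of the two sides of every conjunction is shifted by a large constant; and in
  \<open>FO(RPR)\<close> the order is defined by the recursion \<open>Q(z, t) \<equiv> Q(z, t - 1) \<or> t = z + 1\<close>.
\<close>

text \<open>The recursion of \<open>form\<close> through lists of triples makes the generated rule
  speak of the set functions of products. Here the \<open>Rpr\<close> case offers the hypothesis
  directly for each triple in \<open>set ds\<close>.\<close>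

lemma form_induct [case_names Pred Eq Less Succ Cong Rel RelPrev Neg And Or Imp Ex All Rpr]:
  assumes "\<And>A x. P (Pred A x)" "\<And>x y. P (Eq x y)" "\<And>x y. P (Less x y)" "\<And>x y. P (Succ x y)"
    "\<And>x n. P (Cong x n)" "\<And>Q ys x. P (Rel Q ys x)" "\<And>Q ys x. P (RelPrev Q ys x)"
    "\<And>\<phi>. P \<phi> \<Longrightarrow> P (Neg \<phi>)"
    "\<And>\<phi> \<psi>. P \<phi> \<Longrightarrow> P \<psi> \<Longrightarrow> P (And \<phi> \<psi>)"
    "\<And>\<phi> \<psi>. P \<phi> \<Longrightarrow> P \<psi> \<Longrightarrow> P (Or \<phi> \<psi>)"
    "\<And>\<phi> \<psi>. P \<phi> \<Longrightarrow> P \<psi> \<Longrightarrow> P (Imp \<phi> \<psi>)"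
    "\<And>x \<phi>. P \<phi> \<Longrightarrow> P (Ex x \<phi>)" "\<And>x \<phi>. P \<phi> \<Longrightarrow> P (All x \<phi>)"
    "\<And>ds t \<psi>. (\<And>Q zs \<theta>. (Q, zs, \<theta>) \<in> set ds \<Longrightarrow> P \<theta>) \<Longrightarrow> P \<psi> \<Longrightarrow> P (Rpr ds t \<psi>)"
  shows "P \<phi>"
proof (induction \<phi>)
  case (Rpr ds t \<psi>)
  then show ?case
    by (intro assms(14)) (force simp: prod_set_defs)+
qed (use assms in auto)

text \<open>Since \<open>zip\<close> truncates, equal lengths are what guarantees that every
  variable of \<open>zs\<close> takes its value from \<open>bs\<close>; the base assignment then
  matters only outside \<open>zs\<close>.\<close>

lemma assign_eq:
  assumes "length bs = length zs" "x \<notin> set zs \<Longrightarrow> e x = e' x"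
  shows "assign e zs bs x = assign e' zs bs x"
proof (cases "x \<in> set zs")
  case True
  then have "x \<in> dom (map_of (zip zs bs))"
    using assms(1) by simp
  then show ?thesis
    by (auto simp: assign_def)
next
  case False
  then have "map_of (zip zs bs) x = None"
    using assms(1) by simp
  then show ?thesis
    using assms(2) False by (simp add: assign_def)
qed

lemma map_of_map_snd:
  "map_of (map (\<lambda>(Q, zs, \<theta>). (Q, g zs \<theta>)) ds) Q = map_option (\<lambda>(zs, \<theta>). g zs \<theta>) (map_of ds Q)"
  by (induction ds) auto

lemma map_of_map_inj:
  assumes "inj f"
  shows "map_of (map (\<lambda>(Q, zs, \<theta>). (f Q, g zs \<theta>)) ds) (f Q) =
    map_option (\<lambda>(zs, \<theta>). g zs \<theta>) (map_of ds Q)"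
  by (induction ds) (auto simp: inj_eq[OF assms])

subsection \<open>Coincidence\<close>

fun arity :: "usage \<Rightarrow> nat" where
  "arity (Anywhere n) = n"
| "arity (Stage zs t) = length zs"

text \<open>Applying a defined relation to too short a tuple would leave some of its parameters to the
  current assignment; hence interpretations are compared only on tuples of the right length.\<close>

definition agree :: "(nat \<rightharpoonup> usage) \<Rightarrow> (nat \<Rightarrow> int list \<Rightarrow> int \<Rightarrow> bool) \<Rightarrow>
    (nat \<Rightarrow> int list \<Rightarrow> int \<Rightarrow> bool) \<Rightarrow> bool" where
  "agree \<Gamma> R R' \<longleftrightarrow>
     (\<forall>Q u bs k. \<Gamma> Q = Some u \<longrightarrow> length bs = arity u \<longrightarrow> R Q bs k = R' Q bs k)"

lemma agree_hide: "agree \<Gamma> R R' \<Longrightarrow> agree (hide X \<Gamma>) R R'"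
  unfolding agree_def hide_def by (auto split: option.splits usage.splits if_splits)

text \<open>With the empty environment this says that the truth of a formula depends only on its
  free individual variables. General \<Gamma> and two interpretations are needed for the induction,
  because the stages of a recursion computed from \<open>e\<close> and from \<open>e'\<close> are
  different relations that agree only on tuples of the declared length.\<close>

lemma sat_cong:
  assumes "scoped \<Gamma> \<phi>" "agree \<Gamma> R R'" "\<And>x. x \<in> fv \<phi> \<Longrightarrow> e x = e' x"
  shows "sat \<A> R e \<phi> = sat \<A> R' e' \<phi>"
  using assms
proof (induction \<phi> arbitrary: \<Gamma> R R' e e' rule: form_induct)
  case (Rel Q ys x)
  then have *: "map e ys = map e' ys" "e x = e' x"
    by auto
  show ?case
    using Rel.prems(1,2) by (simp add: * agree_def)
next
  case (RelPrev Q ys x)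
  then have *: "map e ys = map e' ys" "e x = e' x"
    by auto
  show ?case
    using RelPrev.prems(1,2) by (simp add: * agree_def)
next
  case (And \<phi> \<psi>)
  show ?case
    using And.prems And.IH(1)[of \<Gamma> R R' e e'] And.IH(2)[of \<Gamma> R R' e e'] by simp
next
  case (Or \<phi> \<psi>)
  show ?case
    using Or.prems Or.IH(1)[of \<Gamma> R R' e e'] Or.IH(2)[of \<Gamma> R R' e e'] by simp
next
  case (Imp \<phi> \<psi>)
  show ?case
    using Imp.prems Imp.IH(1)[of \<Gamma> R R' e e'] Imp.IH(2)[of \<Gamma> R R' e e'] by simp
next
  case (Neg \<phi>)
  show ?case
    using Neg.prems Neg.IH[of \<Gamma> R R' e e'] by simp
next
  case (Ex x \<phi>)
  have "sat \<A> R (e(x := l)) \<phi> = sat \<A> R' (e'(x := l)) \<phi>" for l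
    by (rule Ex.IH[OF _ agree_hide[OF Ex.prems(2)]]) (use Ex.prems in auto)
  then show ?case
    by simp
next
  case (All x \<phi>)
  have "sat \<A> R (e(x := l)) \<phi> = sat \<A> R' (e'(x := l)) \<phi>" for l
    by (rule All.IH[OF _ agree_hide[OF All.prems(2)]]) (use All.prems in auto)
  then show ?case
    by simp
next
  case (Rpr ds t \<psi>)
  define ds' where "ds' = map (\<lambda>(Q, zs, \<theta>). (Q, zs, \<lambda>R' e'. sat \<A> R' e' \<theta>)) ds"
  have ds': "map_of ds' Q = map_option (\<lambda>(zs, \<theta>). (zs, \<lambda>R' e'. sat \<A> R' e' \<theta>)) (map_of ds Q)" for Q
    unfolding ds'_def by (rule map_of_map_snd)
  define \<Delta> where "\<Delta> = \<Gamma> ++ map_of (map (\<lambda>(Q', zs', \<theta>'). (Q', Anywhere (length zs'))) ds)"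
  have \<Delta>: "\<Delta> Q = (case map_of ds Q of None \<Rightarrow> \<Gamma> Q | Some (zs, \<theta>) \<Rightarrow> Some (Anywhere (length zs)))" for Q
    unfolding \<Delta>_def map_add_def map_of_map_snd by (auto split: option.splits)
  \<comment> \<open>The comparison is made under \<open>\<Delta>\<close>, the environment in which
    \<psi> is scoped, so that the last stage can be passed to the induction hypothesis for
    \<psi>.\<close>
  have stage: "agree \<Delta> (rpr_stage ds' t R e m) (rpr_stage ds' t R' e' m)" for m
  proof (induction m)
    case 0
    show ?case
      using Rpr.prems(2) by (auto simp: agree_def \<Delta> ds' split: option.splits)
  next
    case (Suc m)
    let ?S = "rpr_stage ds' t R e m" and ?S' = "rpr_stage ds' t R' e' m"
    have body: "sat \<A> ?S ((assign e zs bs)(t := int m)) \<theta> =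
        sat \<A> ?S' ((assign e' zs bs)(t := int m)) \<theta>"
      if Q: "map_of ds Q = Some (zs, \<theta>)" and len: "length bs = length zs" for Q zs \<theta> bs
    proof -
      have mem: "(Q, zs, \<theta>) \<in> set ds"
        using Q by (rule map_of_SomeD)
      let ?\<Gamma> = "hide (insert t (set zs)) \<Gamma> ++ map_of (map (\<lambda>(Q', zs', \<theta>'). (Q', Stage zs' t)) ds)"
      have "scoped ?\<Gamma> \<theta>"
        using Rpr.prems(1) mem by auto
      moreover have "?S Q' bs k = ?S' Q' bs k"
        if \<Gamma>: "?\<Gamma> Q' = Some u" and "length bs = arity u" for Q' u bs k
      proof -
        \<comment> \<open>A right-hand side sees the defined relations as \<open>Stage\<close> where
          \<open>\<Delta>\<close> has \<open>Anywhere\<close>, and \<open>hide\<close> may have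
          dropped entries of \<Gamma>. Neither changes an arity, which is all that
          \<open>agree\<close> inspects.\<close>
        have "\<exists>u'. \<Delta> Q' = Some u' \<and> arity u' = arity u"
          using \<Gamma> unfolding \<Delta> map_add_def map_of_map_snd hide_def
          by (auto split: option.splits usage.splits if_splits)
        then show ?thesis
          using Suc \<open>length bs = arity u\<close> unfolding agree_def by metis
      qed
      then have "agree ?\<Gamma> ?S ?S'"
        unfolding agree_def by blast
      moreover have "((assign e zs bs)(t := int m)) x = ((assign e' zs bs)(t := int m)) x"
        if "x \<in> fv \<theta>" for x
      proof (cases "x = t")
        case False
        \<comment> \<open>A variable of \<theta> outside \<open>zs\<close> and different from
          \<open>t\<close> is free in the whole \<open>Rpr\<close> formula, so the two assignments
          agree on it.\<close>
        have "assign e zs bs x = assign e' zs bs x"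
          by (rule assign_eq[OF len], rule Rpr.prems(3)) (use that mem False in force)
        then show ?thesis
          by simp
      qed simp
      ultimately show ?thesis
        by (rule Rpr.IH(1)[OF mem])
    qed
    show ?case
      using Suc Rpr.prems(2) body unfolding agree_def \<Delta> rpr_stage.simps ds'
      by (auto split: option.splits)
  qed
  have "scoped \<Delta> \<psi>"
    using Rpr.prems(1) by (simp add: \<Delta>_def)
  then show ?case
    unfolding sat.simps ds'_def[symmetric]
    by (rule Rpr.IH(2)[OF _ stage]) (use Rpr.prems(3) in auto)
qed simp_all

subsection \<open>Renaming relation variables\<close>

text \<open>Defined and free relation variables are renamed alike, so no capture can arise as long
  as \<open>f\<close> is injective.\<close>

fun rename :: "(nat \<Rightarrow> nat) \<Rightarrow> form \<Rightarrow> form" where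
  "rename f (Rel Q ys x) = Rel (f Q) ys x"
| "rename f (RelPrev Q ys x) = RelPrev (f Q) ys x"
| "rename f (Neg \<phi>) = Neg (rename f \<phi>)"
| "rename f (And \<phi> \<psi>) = And (rename f \<phi>) (rename f \<psi>)"
| "rename f (Or \<phi> \<psi>) = Or (rename f \<phi>) (rename f \<psi>)"
| "rename f (Imp \<phi> \<psi>) = Imp (rename f \<phi>) (rename f \<psi>)"
| "rename f (Ex x \<phi>) = Ex x (rename f \<phi>)"
| "rename f (All x \<phi>) = All x (rename f \<phi>)"
| "rename f (Rpr ds t \<psi>) = Rpr (map (\<lambda>(Q, zs, \<theta>). (f Q, zs, rename f \<theta>)) ds) t (rename f \<psi>)"
| "rename f \<phi> = \<phi>"

lemma fv_rename [simp]: "fv (rename f \<phi>) = fv \<phi>"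
  by (induction \<phi> rule: form_induct) (force split: prod.splits)+

lemma in_logic_rename [simp]: "in_logic L (rename f \<phi>) = in_logic L \<phi>"
  by (induction \<phi> rule: form_induct) (force split: prod.splits)+

lemma defined_rels_rename: "defined_rels (rename f \<phi>) = map f (defined_rels \<phi>)"
proof (induction \<phi> rule: form_induct)
  case (Rpr ds t \<psi>)
  then show ?case
    by (auto simp: map_concat intro!: arg_cong[where f = concat])
qed simp_all

text \<open>Whether \<open>hide\<close> drops an entry depends on its usage alone, never on the name
  of the relation variable.\<close>

lemma hide_comp: "(\<lambda>Q. hide X \<Gamma> (f Q)) = hide X (\<lambda>Q. \<Gamma> (f Q))"
  by (simp add: hide_def)

lemma map_add_map_of_comp:
  assumes "inj f"
  shows "(\<lambda>Q. (\<Gamma> ++ map_of (map (\<lambda>(Q, zs, \<theta>). (f Q, g zs)) ds)) (f Q)) =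
    (\<lambda>Q. \<Gamma> (f Q)) ++ map_of (map (\<lambda>(Q, zs, \<theta>). (Q, g zs)) ds)"
  by (rule ext) (simp add: map_add_def map_of_map_inj[OF assms] map_of_map_snd)

lemma ball_map_triple:
  "(\<forall>(Q, zs, \<theta>)\<in>set (map (\<lambda>(Q, zs, \<theta>). (f Q, zs, g \<theta>)) ds). P Q zs \<theta>) \<longleftrightarrow>
    (\<forall>(Q, zs, \<theta>)\<in>set ds. P (f Q) zs (g \<theta>))"
  by (induction ds) auto

lemma ball_triple_cong:
  assumes "\<And>Q zs \<theta>. (Q, zs, \<theta>) \<in> A \<Longrightarrow> P Q zs \<theta> \<longleftrightarrow> P' Q zs \<theta>"
  shows "(\<forall>(Q, zs, \<theta>)\<in>A. P Q zs \<theta>) \<longleftrightarrow> (\<forall>(Q, zs, \<theta>)\<in>A. P' Q zs \<theta>)"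
  using assms by auto

text \<open>Environments pull back along \<open>f\<close>; injectivity ensures that looking up
  \<open>f Q\<close> among the renamed definitions finds the definition of \<open>Q\<close>.\<close>

lemma scoped_rename:
  assumes "inj f"
  shows "scoped \<Gamma> (rename f \<phi>) = scoped (\<lambda>Q. \<Gamma> (f Q)) \<phi>"
proof (induction \<phi> arbitrary: \<Gamma> rule: form_induct)
  case (Rpr ds t \<psi>)
  let ?ds = "map (\<lambda>(Q, zs, \<theta>). (f Q, zs, rename f \<theta>)) ds"
  have comp: "map (\<lambda>(Q, zs, \<theta>). (Q, g zs)) ?ds = map (\<lambda>(Q, zs, \<theta>). (f Q, g zs)) ds"
    for g :: "nat list \<Rightarrow> usage"
    by auto
  have vars: "(\<Union>(Q, zs, \<theta>)\<in>set ?ds. set zs) = (\<Union>(Q, zs, \<theta>)\<in>set ds. set zs)"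
    by auto
  have body: "scoped (hide X \<Gamma> ++ map_of (map (\<lambda>(Q, zs, \<theta>). (f Q, Stage zs t)) ds)) (rename f \<theta>) =
      scoped (hide X (\<lambda>Q. \<Gamma> (f Q)) ++ map_of (map (\<lambda>(Q, zs, \<theta>). (Q, Stage zs t)) ds)) \<theta>"
    if "(Q, zs, \<theta>) \<in> set ds" for Q zs \<theta> X
    by (subst Rpr.IH(1)[OF that]) (simp only: map_add_map_of_comp[OF assms] hide_comp[where f = f])
  show ?case
    unfolding rename.simps scoped.simps comp vars
    by (rule arg_cong2[where f = "(\<and>)"], unfold ball_map_triple, rule ball_triple_cong)
      (simp_all only: fv_rename body Rpr.IH(2) map_add_map_of_comp[OF assms])
qed (simp_all add: hide_comp[where f = f])

text \<open>The second assumption is the induction hypothesis of \<open>sat_rename\<close> for the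
  right-hand sides. The induction on \<open>m\<close> keeps \<open>Q\<close> arbitrary because a
  right-hand side may consult every relation of the previous stage.\<close>

lemma rpr_stage_rename:
  fixes ds :: "(nat \<times> nat list \<times> form) list" and f :: "nat \<Rightarrow> nat"
  assumes "inj f"
    and "\<And>Q zs \<theta> R e. (Q, zs, \<theta>) \<in> set ds \<Longrightarrow> sat \<A> R e (rename f \<theta>) = sat \<A> (\<lambda>Q. R (f Q)) e \<theta>"
  defines "ds' \<equiv> map (\<lambda>(Q, zs, \<theta>). (f Q, zs, \<lambda>R e. sat \<A> R e (rename f \<theta>))) ds"
    and "ds'' \<equiv> map (\<lambda>(Q, zs, \<theta>). (Q, zs, \<lambda>R e. sat \<A> R e \<theta>)) ds"
  shows "rpr_stage ds' t R e m (f Q) = rpr_stage ds'' t (\<lambda>Q. R (f Q)) e m Q"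
proof (induction m arbitrary: Q)
  case 0
  show ?case
    by (rule ext)+ (simp add: ds'_def ds''_def map_of_map_inj[OF assms(1)] map_of_map_snd option.case_eq_if)
next
  case (Suc m)
  show ?case
  proof (cases "map_of ds Q")
    case (Some d)
    moreover obtain zs \<theta> where "d = (zs, \<theta>)"
      by (cases d)
    ultimately have "(Q, zs, \<theta>) \<in> set ds" "map_of ds' (f Q) = Some (zs, \<lambda>R e. sat \<A> R e (rename f \<theta>))"
        "map_of ds'' Q = Some (zs, \<lambda>R e. sat \<A> R e \<theta>)"
      by (auto simp: ds'_def ds''_def map_of_map_inj[OF assms(1)] map_of_map_snd dest: map_of_SomeD)
    then show ?thesis
      by (intro ext) (simp add: assms(2) Suc)
  qed (simp add: ds'_def ds''_def map_of_map_inj[OF assms(1)] map_of_map_snd)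
qed

lemma sat_rename:
  assumes "inj f"
  shows "sat \<A> R e (rename f \<phi>) = sat \<A> (\<lambda>Q. R (f Q)) e \<phi>"
proof (induction \<phi> arbitrary: R e rule: form_induct)
  case (Rpr ds t \<psi>)
  have "map (\<lambda>(Q, zs, \<theta>). (Q, zs, \<lambda>R e. sat \<A> R e \<theta>)) (map (\<lambda>(Q, zs, \<theta>). (f Q, zs, rename f \<theta>)) ds)
      = map (\<lambda>(Q, zs, \<theta>). (f Q, zs, \<lambda>R e. sat \<A> R e (rename f \<theta>))) ds"
    by auto
  then show ?case
    by (simp only: rename.simps sat.simps Rpr.IH(2) rpr_stage_rename[OF assms Rpr.IH(1)])
qed simp_all

subsection \<open>Expressible properties of assignments\<close>

text \<open>A semantic notion of definability: the closure properties below can be combined without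
  carrying formulas along. Requiring all values of \<open>e\<close>, not only those on
  \<open>X\<close>, to lie in \<open>tem \<A>\<close> is preserved by the updates that quantifiers
  make.\<close>

definition expressible :: "logic \<Rightarrow> nat set \<Rightarrow> (data \<Rightarrow> (nat \<Rightarrow> int) \<Rightarrow> bool) \<Rightarrow> bool" where
  "expressible L X P \<longleftrightarrow>
     (\<exists>\<phi>. is_formula L \<phi> \<and> fv \<phi> \<subseteq> X \<and>
        (\<forall>\<A> e. data_instance \<A> \<longrightarrow> range e \<subseteq> tem \<A> \<longrightarrow>
           (sat \<A> (\<lambda>_ _ _. False) e \<phi> \<longleftrightarrow> P \<A> e)))"

lemma expressible_cong:
  assumes "expressible L X P"
    and "\<And>\<A> e. data_instance \<A> \<Longrightarrow> range e \<subseteq> tem \<A> \<Longrightarrow> P \<A> e \<longleftrightarrow> P' \<A> e" "X \<subseteq> X'"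
  shows "expressible L X' P'"
  using assms unfolding expressible_def by (metis subset_trans)

lemma expressible_not:
  assumes "expressible L X P"
  shows "expressible L X (\<lambda>\<A> e. \<not> P \<A> e)"
proof -
  obtain \<phi> where "is_formula L \<phi>" "fv \<phi> \<subseteq> X" "\<And>\<A> e. data_instance \<A> \<Longrightarrow> range e \<subseteq> tem \<A> \<Longrightarrow>
      sat \<A> (\<lambda>_ _ _. False) e \<phi> \<longleftrightarrow> P \<A> e"
    using assms unfolding expressible_def by blast
  then show ?thesis
    unfolding expressible_def by (intro exI[of _ "Neg \<phi>"]) (simp add: is_formula_def)
qed

lemma expressible_and:
  assumes "expressible L X P" "expressible L Y P'"
  shows "expressible L (X \<union> Y) (\<lambda>\<A> e. P \<A> e \<and> P' \<A> e)"
proof -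
  obtain \<phi> where \<phi>: "is_formula L \<phi>" "fv \<phi> \<subseteq> X" "\<And>\<A> e. data_instance \<A> \<Longrightarrow> range e \<subseteq> tem \<A> \<Longrightarrow>
      sat \<A> (\<lambda>_ _ _. False) e \<phi> \<longleftrightarrow> P \<A> e"
    using assms(1) unfolding expressible_def by blast
  obtain \<psi> where \<psi>: "is_formula L \<psi>" "fv \<psi> \<subseteq> Y" "\<And>\<A> e. data_instance \<A> \<Longrightarrow> range e \<subseteq> tem \<A> \<Longrightarrow>
      sat \<A> (\<lambda>_ _ _. False) e \<psi> \<longleftrightarrow> P' \<A> e"
    using assms(2) unfolding expressible_def by blast
  \<comment> \<open>\<open>N\<close> exceeds every relation variable defined in
    \<open>\<phi>\<close>, so adding \<open>N\<close> moves those of \<open>\<psi>\<close> out of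
    their way while remaining injective.\<close>
  obtain N where N: "\<And>Q. Q \<in> set (defined_rels \<phi>) \<Longrightarrow> Q < N"
    using finite_nat_set_iff_bounded[of "set (defined_rels \<phi>)"] by auto
  define f where "f Q = N + Q" for Q
  have "inj f"
    by (simp add: f_def inj_def)
  note ren = sat_rename[OF \<open>inj f\<close>] scoped_rename[OF \<open>inj f\<close>] defined_rels_rename
  have "inj_on f A" for A
    using \<open>inj f\<close> by (rule inj_on_subset) simp
  moreover have "set (defined_rels \<phi>) \<inter> f ` set (defined_rels \<psi>) = {}"
    using N by (force simp: f_def)
  ultimately have "is_formula L (And \<phi> (rename f \<psi>))"
    using \<phi>(1) \<psi>(1) by (simp add: is_formula_def ren distinct_map)
  \<comment> \<open>The constantly false interpretation is unchanged by composition with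
    \<open>f\<close>, so the renamed \<open>\<psi>\<close> has the truth value of
    \<open>\<psi>\<close>.\<close>
  then show ?thesis
    unfolding expressible_def
    by (intro exI[of _ "And \<phi> (rename f \<psi>)"]) (use \<phi> \<psi> in \<open>auto simp: ren\<close>)
qed

lemma range_fun_upd_subset: "range e \<subseteq> T \<Longrightarrow> l \<in> T \<Longrightarrow> range (e(x := l)) \<subseteq> T"
  by auto

lemma expressible_ex:
  assumes "expressible L X P"
  shows "expressible L (X - {x}) (\<lambda>\<A> e. \<exists>l\<in>tem \<A>. P \<A> (e(x := l)))"
proof -
  obtain \<phi> where "is_formula L \<phi>" "fv \<phi> \<subseteq> X" "\<And>\<A> e. data_instance \<A> \<Longrightarrow> range e \<subseteq> tem \<A> \<Longrightarrow>
      sat \<A> (\<lambda>_ _ _. False) e \<phi> \<longleftrightarrow> P \<A> e"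
    using assms unfolding expressible_def by blast
  moreover have "hide {x} Map.empty = Map.empty"
    by (auto simp: hide_def)
  ultimately show ?thesis
    unfolding expressible_def
    by (intro exI[of _ "Ex x \<phi>"]) (auto simp: is_formula_def range_fun_upd_subset simp del: fun_upd_apply)
qed

text \<open>By De Morgan, so that relation variables have to be kept apart only for
  conjunctions.\<close>

lemma expressible_or:
  assumes "expressible L X P" "expressible L Y P'"
  shows "expressible L (X \<union> Y) (\<lambda>\<A> e. P \<A> e \<or> P' \<A> e)"
  using expressible_not[OF expressible_and[OF assms[THEN expressible_not]]] by simp

lemma expressible_all:
  assumes "expressible L X P"
  shows "expressible L (X - {x}) (\<lambda>\<A> e. \<forall>l\<in>tem \<A>. P \<A> (e(x := l)))"
  using expressible_not[OF expressible_ex[OF expressible_not[OF assms]]] by simp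

section \<open>Expressing the atoms of epistemic formulas\<close>

lemma expressible_eq: "expressible L {x, y} (\<lambda>\<A> e. e x = e y)"
  unfolding expressible_def by (intro exI[of _ "Eq x y"]) (auto simp: is_formula_def)

lemma expressible_less: "expressible L {x, y} (\<lambda>\<A> e. e x < e y)"
proof (cases "L = FO_RPR")
  case False
  then have "L \<in> {FO_less, FO_less_cong}"
    by (cases L) auto
  then show ?thesis
    unfolding expressible_def by (intro exI[of _ "Less x y"]) (auto simp: is_formula_def)
next
  case True
  let ?\<theta> = "Or (RelPrev 0 [0] 1) (Succ 1 0)"
  let ?\<phi> = "Rpr [(0, [0], ?\<theta>)] 1 (Rel 0 [x] y)"
  have formula: "is_formula L ?\<phi>" "fv ?\<phi> \<subseteq> {x, y}"
    using True by (auto simp: is_formula_def)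
  define ds where "ds = [(0::nat, [0::nat], \<lambda>(R :: nat \<Rightarrow> int list \<Rightarrow> int \<Rightarrow> bool) (e :: nat \<Rightarrow> int).
      R 0 [e 0] (e 1 - 1) \<or> e 1 = e 0 + 1)]"
  have ds: "map_of ds 0 = Some ([0], \<lambda>R e. R 0 [e 0] (e 1 - 1) \<or> e 1 = e 0 + 1)"
    by (simp add: ds_def)
  have sat_rpr: "sat \<A> R e ?\<phi> \<longleftrightarrow> rpr_stage ds 1 R e (card (tem \<A>)) 0 [e x] (e y)" for \<A> R e
    by (simp add: ds_def)
  \<comment> \<open>The relation switches on at \<open>a + 1\<close> and then stays on. The
    condition on \<open>a\<close> ensures that the recursion, which starts at 0, reaches that point;
    at \<open>m = 0\<close> the lookup at -1 yields false.\<close>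
  have stage: "rpr_stage ds 1 R e m 0 [a] k \<longleftrightarrow> a < k \<and> 0 \<le> k \<and> k < int m" if "0 \<le> a" for R e m a k
  proof (induction m arbitrary: k)
    case 0
    show ?case
      by (simp add: ds)
  next
    case (Suc m)
    have "rpr_stage ds 1 R e (Suc m) 0 [a] k \<longleftrightarrow>
        (if k = int m then rpr_stage ds 1 R e m 0 [a] (int m - 1) \<or> int m = a + 1
         else rpr_stage ds 1 R e m 0 [a] k)"
      by (simp add: ds assign_def)
    also have "\<dots> \<longleftrightarrow> a < k \<and> 0 \<le> k \<and> k < int (Suc m)"
      unfolding Suc using that by auto
    finally show ?case .
  qed
  have "sat \<A> (\<lambda>_ _ _. False) e ?\<phi> \<longleftrightarrow> e x < e y"
    if "data_instance \<A>" "range e \<subseteq> tem \<A>" for \<A> e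
  proof -
    \<comment> \<open>As the least time point is 0, the cardinality of \<open>tem \<A>\<close> is
      the maximum plus one, and the recursion covers every point.\<close>
    have tem: "tem \<A> = {0..Max (snd ` \<A>)}"
      using that(1) by (simp add: data_instance_def tem_def)
    have "e x \<in> tem \<A>" "e y \<in> tem \<A>"
      using that(2) by auto
    then show ?thesis
      unfolding sat_rpr tem by (subst stage) auto
  qed
  then show ?thesis
    using formula unfolding expressible_def by blast
qed

text \<open>The successor is the next point in the order, which gives one definition for all three
  logics.\<close>

lemma expressible_succ: "expressible L {x, y} (\<lambda>\<A> e. e x = e y + 1)"
proof -
  obtain z where z: "z \<noteq> x" "z \<noteq> y"
    using ex_new_if_finite[of "{x, y}"] by auto
  have "expressible L ({y, x} \<union> ({y, z} \<union> {z, x} - {z}))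
    (\<lambda>\<A> e. e y < e x \<and> \<not> (\<exists>l\<in>tem \<A>. (e(z := l)) y < (e(z := l)) z \<and> (e(z := l)) z < (e(z := l)) x))"
    by (intro expressible_and expressible_not expressible_ex expressible_less)
  then show ?thesis
  proof (rule expressible_cong)
    fix \<A> :: data and e :: "nat \<Rightarrow> int"
    assume "range e \<subseteq> tem \<A>"
    then have *: "e y \<in> tem \<A>" "e x \<in> tem \<A>"
      by auto
    have "(\<exists>l\<in>tem \<A>. e y < l \<and> l < e x) \<longleftrightarrow> e y + 1 < e x"
    proof
      \<comment> \<open>The witness \<open>e y + 1\<close> lies in \<open>tem \<A>\<close> because
        this set is an interval.\<close>
      assume "e y + 1 < e x"
      then show "\<exists>l\<in>tem \<A>. e y < l \<and> l < e x"
        using * by (intro bexI[of _ "e y + 1"]) (auto simp: tem_def)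
    qed auto
    then show "e y < e x \<and> \<not> (\<exists>l\<in>tem \<A>. (e(z := l)) y < (e(z := l)) z \<and> (e(z := l)) z < (e(z := l)) x)
        \<longleftrightarrow> e x = e y + 1"
      using z by auto
  qed auto
qed

text \<open>A rewriting comes with its own variable \<open>x\<close>. Quantifying \<open>x\<close>
  under the equation \<open>x = y\<close> moves it to \<open>y\<close> without capture-avoiding
  substitution; if the two coincide, nothing has to be moved.\<close>

lemma expressible_concept:
  assumes "ompiq_rewritable L \<O> \<kappa>"
  shows "expressible L {y} (\<lambda>\<A> e. e y \<in> ans \<O> \<kappa> \<A>)"
proof -
  obtain \<phi> x where \<phi>: "is_formula L \<phi>" "fv \<phi> \<subseteq> {x}"
    "\<And>\<A>. data_instance \<A> \<Longrightarrow> ans \<O> \<kappa> \<A> = {l \<in> tem \<A>. holds \<A> \<phi> [x] [l]}"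
    using assms unfolding ompiq_rewritable_def by blast
  have "sat \<A> (\<lambda>_ _ _. False) e \<phi> \<longleftrightarrow> e x \<in> ans \<O> \<kappa> \<A>"
    if "data_instance \<A>" "range e \<subseteq> tem \<A>" for \<A> e
  proof -
    \<comment> \<open>\<open>holds\<close> evaluates under the assignment that is 0 away from
      \<open>x\<close>; coincidence replaces it by \<open>e\<close>, as only \<open>x\<close> can be
      free in \<open>\<phi>\<close>.\<close>
    have "holds \<A> \<phi> [x] [e x] \<longleftrightarrow> sat \<A> (\<lambda>_ _ _. False) e \<phi>"
      unfolding holds_def
      by (rule sat_cong[of Map.empty]) (use \<phi> in \<open>auto simp: is_formula_def agree_def assign_def\<close>)
    then show ?thesis
      using that \<phi>(3) by auto
  qed
  then have x: "expressible L {x} (\<lambda>\<A> e. e x \<in> ans \<O> \<kappa> \<A>)"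
    using \<phi> unfolding expressible_def by blast
  show ?thesis
  proof (cases "x = y")
    case False
    show ?thesis
      by (rule expressible_cong[OF expressible_ex[OF expressible_and[OF expressible_eq[of L x y] x],
              of x]]) (use False in auto)
  qed (use x in simp)
qed

section \<open>Translating epistemic formulas\<close>

lemma expressible_esat:
  assumes "\<forall>\<kappa>\<in>constituents \<psi>. ompiq_rewritable L \<O> \<kappa>"
  shows "expressible L (efv \<psi>) (\<lambda>\<A> e. esat \<O> \<A> e \<psi>)"
  using assms
proof (induction \<psi>)
  case (EConcept \<kappa> x)
  then show ?case
    by (simp add: expressible_concept)
next
  case (ELess x y)
  show ?case
    by (simp add: expressible_less)
next
  case (EEq x y)
  show ?case
    by (simp add: expressible_eq)
next
  case (ESucc x y)
  show ?case
    by (simp add: expressible_succ)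
next
  case (EAnd \<phi> \<psi>)
  then have "expressible L (efv \<phi>) (\<lambda>\<A> e. esat \<O> \<A> e \<phi>)"
    and "expressible L (efv \<psi>) (\<lambda>\<A> e. esat \<O> \<A> e \<psi>)"
    by simp_all
  from expressible_and[OF this] show ?case
    by (simp only: efv.simps esat.simps)
next
  case (EOr \<phi> \<psi>)
  then have "expressible L (efv \<phi>) (\<lambda>\<A> e. esat \<O> \<A> e \<phi>)"
    and "expressible L (efv \<psi>) (\<lambda>\<A> e. esat \<O> \<A> e \<psi>)"
    by simp_all
  from expressible_or[OF this] show ?case
    by (simp only: efv.simps esat.simps)
next
  case (EImp \<phi> \<psi>)
  then have "expressible L (efv \<phi>) (\<lambda>\<A> e. esat \<O> \<A> e \<phi>)"
    and "expressible L (efv \<psi>) (\<lambda>\<A> e. esat \<O> \<A> e \<psi>)"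
    by simp_all
  from expressible_or[OF expressible_not[OF this(1)] this(2)] show ?case
    by (simp only: efv.simps esat.simps imp_conv_disj)
next
  case (ENot \<phi>)
  then have "expressible L (efv \<phi>) (\<lambda>\<A> e. esat \<O> \<A> e \<phi>)"
    by simp
  from expressible_not[OF this] show ?case
    by (simp only: efv.simps esat.simps)
next
  case (EEx x \<phi>)
  then have "expressible L (efv \<phi>) (\<lambda>\<A> e. esat \<O> \<A> e \<phi>)"
    by simp
  from expressible_ex[OF this] show ?case
    by (simp only: efv.simps esat.simps)
next
  case (EAll x \<phi>)
  then have "expressible L (efv \<phi>) (\<lambda>\<A> e. esat \<O> \<A> e \<phi>)"
    by simp
  from expressible_all[OF this] show ?case
    by (simp only: efv.simps esat.simps)
qed

theorem theorem33:
  fixes L :: logic and \<O> :: "clause set" and \<psi> :: eform and xs :: "nat list"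
  assumes "ontology \<O>"
    and "distinct xs" and "set xs = efv \<psi>"
    and "\<And>\<kappa>. \<kappa> \<in> constituents \<psi> \<Longrightarrow> ompiq_rewritable L \<O> \<kappa>"
  shows "eomq_rewritable L \<O> \<psi> xs"
proof -
  obtain \<phi> where \<phi>: "is_formula L \<phi>" "fv \<phi> \<subseteq> efv \<psi>"
    "\<And>\<A> e. data_instance \<A> \<Longrightarrow> range e \<subseteq> tem \<A> \<Longrightarrow>
      sat \<A> (\<lambda>_ _ _. False) e \<phi> \<longleftrightarrow> esat \<O> \<A> e \<psi>"
    using expressible_esat[of \<psi> L \<O>] assms(4) unfolding expressible_def by blast
  \<comment> \<open>The default value 0 is itself a time point of every data instance, so these
    assignments are among those that \<open>expressible\<close> covers.\<close>
  have "range (assign (\<lambda>_. 0) xs ls) \<subseteq> tem \<A>"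
    if "data_instance \<A>" "set ls \<subseteq> tem \<A>" for \<A> ls
  proof -
    have "0 \<in> tem \<A>"
      using that(1) by (auto simp: data_instance_def tem_def)
    then show ?thesis
      using that(2) by (auto simp: assign_def split: option.splits dest!: map_of_SomeD set_zip_rightD)
  qed
  then have "eomq_answer \<O> \<psi> xs \<A> ls \<longleftrightarrow> holds \<A> \<phi> xs ls"
    if "data_instance \<A>" "set ls \<subseteq> tem \<A>" for \<A> ls
    using \<phi>(3) that by (simp add: eomq_answer_def holds_def)
  then show ?thesis
    using \<phi>(1,2) assms(3) unfolding eomq_rewritable_def by auto
qed

end
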